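(* Let $\kappa$ be an infinite cardinal, $\lambda$ a cardinal, and assume: (a) $\theta=\operatorname{cf}(\lambda)\le\kappa<\lambda$; (b) $\langle\lambda_i:i<\kappa\rangle$ is a sequence of infinite cardinals; (c) $\lim_D(\langle\lambda_i:i<\kappa\rangle)=\lambda$; (d) $\lambda_i^{\kappa}<\lambda$ for every $i<\kappa$; (e) $D$ is an ultrafilter on $\kappa$; (f) $D$ is not closed under descending sequences of length $\theta$; (g) $\left|\prod_{i<\kappa}\lambda_i/D\right|=\lambda$. Then $D$ is $(\kappa,\theta)$-weakly normal.
   Context: Limit along $D$: for a sequence $\bar\lambda=\langle\lambda_i:i<\kappa\rangle$ of cardinals, $\lim_D(\bar\lambda)$ is the unique cardinal $\mu$ such that $\{i<\kappa:\beta<\lambda_i\le\mu\}\in D$ for every $\beta<\mu$. $D$ is not closed under descending sequences of length $\theta$ if there is a $\subseteq$-decreasing sequence $\langle A_\epsilon:\epsilon<\theta\rangle$ of members of $D$ with $\bigcap_{\epsilon<\theta}A_\epsilon\notin D$. $\prod_{i<\kappa}\lambda_i/D$ is the ultraproduct of the sets $\lambda_i$ modulo $D$. Regressive functions: for $g:\kappa\to\theta$, a function $f:\kappa\to\theta$ is $(\kappa,g)$-regressive if $f(i)<g(i)$ for every $i<\kappa$ with $g(i)>0$. Weak normality: let $g:\kappa\to\theta$. $D$ is $(\kappa,g)$-weakly normal if (i) for every $\epsilon<\theta$, $\{i<\kappa: g(i)\ge\epsilon\}\in D$; and (ii) for every $(\kappa,g)$-regressive $f:\kappa\to\theta$ there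 is $j_f<\theta$ such that $\{i<\kappa: f(i)<j_f\}\in D$. $D$ is $(\kappa,\theta)$-weakly normal if it is $(\kappa,g)$-weakly normal for some $g:\kappa\to\theta$. *)

theory Defs
  imports Main "HOL-Library.FuncSet"
begin

unbundle cardinal_syntax

text \<open>
  Cardinals are the cardinal orders of the library: a cardinal \<open>r\<close> is a relation with
  \<open>Card_order r\<close>, its elements (the ordinals below it) are the members of \<open>Field r\<close>, ordered
  by \<open>r\<close> itself, and cardinals are compared up to isomorphism by \<open>=o\<close>, \<open><o\<close>, \<open>\<le>o\<close>.
\<close>

definition olt :: "'t rel \<Rightarrow> 't \<Rightarrow> 't \<Rightarrow> bool" where
  "olt r x y \<longleftrightarrow> (x, y) \<in> r \<and> x \<noteq> y"

text \<open>
  The library's \<^const>\<open>cofinal\<close> asks for strict upper bounds, which for orders without a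
  greatest element (in particular infinite cardinals) is the usual notion.
\<close>
definition is_cofinality :: "'t rel \<Rightarrow> 'l rel \<Rightarrow> bool" where
  "is_cofinality \<theta> r \<longleftrightarrow> Card_order \<theta> \<and>
     (\<exists>A. A \<subseteq> Field r \<and> cofinal A r \<and> |A| =o \<theta>) \<and>
     (\<forall>A. A \<subseteq> Field r \<and> cofinal A r \<longrightarrow> \<theta> \<le>o |A| )"

definition ultrafilter_on :: "'k set \<Rightarrow> 'k set set \<Rightarrow> bool" where
  "ultrafilter_on K D \<longleftrightarrow>
     D \<subseteq> Pow K \<and> K \<in> D \<and> {} \<notin> D \<and>
     (\<forall>A\<in>D. \<forall>B\<in>D. A \<inter> B \<in> D) \<and>
     (\<forall>A\<in>D. \<forall>B. A \<subseteq> B \<and> B \<subseteq> K \<longrightarrow> B \<in> D) \<and>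
     (\<forall>A. A \<subseteq> K \<longrightarrow> A \<in> D \<or> K - A \<in> D)"

text \<open>
  \<open>is_lim_along K D lam \<mu>\<close> says that \<open>\<mu>\<close> is the limit of \<open>\<langle>lam i : i \<in> K\<rangle>\<close> along \<open>D\<close>. The bound
  \<open>\<beta>\<close> ranges over all ordinals below \<open>\<mu>\<close>; each of them is isomorphic to a proper initial
  segment of \<open>\<mu>\<close>, so the well-orders on the type of \<open>\<mu>\<close> suffice. The condition is vacuous for
  the zero cardinal; apart from that the limit is unique, see \<open>is_lim_along_unique\<close>.
\<close>
definition is_lim_along :: "'k set \<Rightarrow> 'k set set \<Rightarrow> ('k \<Rightarrow> 'a rel) \<Rightarrow> 'l rel \<Rightarrow> bool" where
  "is_lim_along K D lam \<mu> \<longleftrightarrow> Card_order \<mu> \<and>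
     (\<forall>\<beta> :: 'l rel. Well_order \<beta> \<and> \<beta> <o \<mu> \<longrightarrow> {i \<in> K. \<beta> <o lam i \<and> lam i \<le>o \<mu>} \<in> D)"

lemma is_lim_alongD:
  fixes \<mu> \<beta> :: "'l rel"
  assumes "is_lim_along K D lam \<mu>" "\<beta> <o \<mu>"
  shows "{i \<in> K. \<beta> <o lam i \<and> lam i \<le>o \<mu>} \<in> D"
proof -
  have "Well_order \<beta>"
    using assms(2) by (simp add: ordLess_def)
  then show ?thesis
    using assms by (simp add: is_lim_along_def)
qed

lemma is_lim_along_Well_order: "is_lim_along K D lam \<mu> \<Longrightarrow> Well_order \<mu>"
  unfolding is_lim_along_def by (elim conjE) (rule card_order_on_well_order_on)

lemma is_lim_along_not_ordLess:
  fixes \<mu> :: "'l rel" and \<mu>' :: "'m rel"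
  assumes "ultrafilter_on K D" "is_lim_along K D lam \<mu>" "is_lim_along K D lam \<mu>'" "Field \<mu> \<noteq> {}"
  shows "\<not> \<mu> <o \<mu>'"
proof
  assume "\<mu> <o \<mu>'"
  then obtain p :: "'m rel" where p: "\<mu> =o p" "p <o \<mu>'"
    unfolding internalize_ordLess[of \<mu> \<mu>'] by (elim exE conjE)
  define \<beta> :: "'l rel" where "\<beta> = Restr \<mu> (underS \<mu> (SOME x. True))"
  have \<beta>: "\<beta> <o \<mu>"
    unfolding \<beta>_def using is_lim_along_Well_order[OF assms(2)] assms(4) by (rule underS_Restr_ordLess)
  have "\<not> lam i \<le>o \<mu>" if "p <o lam i" for i
    using not_ordLess_ordLeq[OF that] ordLeq_ordIso_trans[OF _ p(1)] by (rule contrapos_nn)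
  then have "{i \<in> K. p <o lam i \<and> lam i \<le>o \<mu>'} \<inter> {i \<in> K. \<beta> <o lam i \<and> lam i \<le>o \<mu>} = {}"
    by blast
  moreover note is_lim_alongD[OF assms(3) p(2)] is_lim_alongD[OF assms(2) \<beta>]
  moreover have "A \<inter> B \<noteq> {}" if "A \<in> D" "B \<in> D" for A B
    using assms(1) that unfolding ultrafilter_on_def by metis
  ultimately show False by (simp only:)
qed

lemma is_lim_along_unique:
  assumes "ultrafilter_on K D" "is_lim_along K D lam \<mu>" "is_lim_along K D lam \<mu>'"
    and "Field \<mu> \<noteq> {}" "Field \<mu>' \<noteq> {}"
  shows "\<mu> =o \<mu>'"
proof -
  have "Well_order \<mu>" "Well_order \<mu>'"
    using assms(2,3) by (simp_all only: is_lim_along_Well_order)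
  then show ?thesis
    using is_lim_along_not_ordLess[OF assms(1-4)] is_lim_along_not_ordLess[OF assms(1,3,2,5)]
    by (simp add: not_ordLess_iff_ordLeq ordIso_iff_ordLeq)
qed

definition closed_under_descending :: "'k set set \<Rightarrow> 't rel \<Rightarrow> bool" where
  "closed_under_descending D \<theta> \<longleftrightarrow>
     \<not> (\<exists>A. (\<forall>\<epsilon>\<in>Field \<theta>. A \<epsilon> \<in> D) \<and>
           (\<forall>\<epsilon> \<zeta>. (\<epsilon>, \<zeta>) \<in> \<theta> \<longrightarrow> A \<zeta> \<subseteq> A \<epsilon>) \<and>
           (\<Inter>\<epsilon>\<in>Field \<theta>. A \<epsilon>) \<notin> D)"

definition ultraproduct :: "'k set \<Rightarrow> 'k set set \<Rightarrow> ('k \<Rightarrow> 'a set) \<Rightarrow> ('k \<Rightarrow> 'a) set set" where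
  "ultraproduct K D X =
     (\<Pi>\<^sub>E i\<in>K. X i) //
     {(f, g). f \<in> (\<Pi>\<^sub>E i\<in>K. X i) \<and> g \<in> (\<Pi>\<^sub>E i\<in>K. X i) \<and> {i \<in> K. f i = g i} \<in> D}"

text \<open>
  \<open>underS \<theta> x \<noteq> {}\<close> expresses \<open>x > 0\<close>.
\<close>
definition regressive :: "'k set \<Rightarrow> 't rel \<Rightarrow> ('k \<Rightarrow> 't) \<Rightarrow> ('k \<Rightarrow> 't) \<Rightarrow> bool" where
  "regressive K \<theta> g f \<longleftrightarrow>
     f \<in> K \<rightarrow> Field \<theta> \<and> (\<forall>i\<in>K. underS \<theta> (g i) \<noteq> {} \<longrightarrow> olt \<theta> (f i) (g i))"

definition weakly_normal_wrt :: "'k set \<Rightarrow> 'k set set \<Rightarrow> 't rel \<Rightarrow> ('k \<Rightarrow> 't) \<Rightarrow> bool" where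
  "weakly_normal_wrt K D \<theta> g \<longleftrightarrow>
     g \<in> K \<rightarrow> Field \<theta> \<and>
     (\<forall>\<epsilon>\<in>Field \<theta>. {i \<in> K. (\<epsilon>, g i) \<in> \<theta>} \<in> D) \<and>
     (\<forall>f. regressive K \<theta> g f \<longrightarrow> (\<exists>j\<in>Field \<theta>. {i \<in> K. olt \<theta> (f i) j} \<in> D))"

definition weakly_normal :: "'k set \<Rightarrow> 'k set set \<Rightarrow> 't rel \<Rightarrow> bool" where
  "weakly_normal K D \<theta> \<longleftrightarrow> (\<exists>g. weakly_normal_wrt K D \<theta> g)"

end

theory Submission
  imports Defs
begin

text \<open>
  Fix an increasing cofinal family \<open>\<langle>v\<^sub>\<epsilon> : \<epsilon> < \<theta>\<rangle>\<close> in \<open>\<lambda>\<close> and let \<open>g(i)\<close> be the least \<open>\<epsilon>\<close> for which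
  \<open>|v\<^sub>\<epsilon>|\<^sup>\<kappa> < \<lambda>\<^sub>i\<close> fails. If \<open>f < g\<close> were not bounded modulo \<open>D\<close>, then \<open>v\<^bsub>f(i)\<^esub>\<close> would tend to \<open>\<lambda>\<close> along
  \<open>D\<close> while \<open>|v\<^bsub>f(i)\<^esub>|\<^sup>\<kappa> \<le> \<lambda>\<^sub>i\<close>. Sending \<open>s : \<kappa> \<rightarrow> \<lambda>\<close> to the class of \<open>i \<mapsto> min(s, v\<^bsub>f(i)\<^esub>)\<close>, with the
  \<open>\<kappa>\<close>-sequence on the right coded by an element of \<open>\<lambda>\<^sub>i\<close>, then embeds \<open>\<lambda>\<^sup>\<kappa>\<close> into the ultraproduct,
  whose size would exceed \<open>\<lambda>\<close> by Koenig's theorem.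
\<close>

section \<open>Cardinal orders and their closed initial segments\<close>

lemma Card_order_not_in:
  assumes "Card_order r" "x \<in> Field r" "y \<in> Field r" "(x, y) \<notin> r"
  shows "(y, x) \<in> r \<and> y \<noteq> x"
proof -
  have r: "wo_rel r"
    using assms(1) by (simp add: wo_rel_def card_order_on_well_order_on)
  then show ?thesis
    using wo_rel.TOTALS[OF r] wo_rel.REFL[OF r] assms by (metis refl_onD)
qed

lemma Card_order_trans: "Card_order r \<Longrightarrow> (x, y) \<in> r \<Longrightarrow> (y, z) \<in> r \<Longrightarrow> (x, z) \<in> r"
  using wo_rel.TRANS[of r] by (metis wo_rel_def card_order_on_well_order_on transD)

lemma Card_order_antisym: "Card_order r \<Longrightarrow> (x, y) \<in> r \<Longrightarrow> (y, x) \<in> r \<Longrightarrow> x = y"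
  using wo_rel.ANTISYM[of r] by (metis wo_rel_def card_order_on_well_order_on antisymD)

lemma Card_order_refl: "Card_order r \<Longrightarrow> x \<in> Field r \<Longrightarrow> (x, x) \<in> r"
  using wo_rel.REFL[of r] by (metis wo_rel_def card_order_on_well_order_on refl_onD)

text \<open>An infinite cardinal has no greatest element, so a closed segment sits inside the strict
  segment of some larger element, and strict segments are small.\<close>

lemma card_of_under_ordLess:
  assumes "Cinfinite r" "a \<in> Field r"
  shows "|under r a| <o r"
proof -
  have r: "Card_order r" "\<not> finite (Field r)"
    using assms(1) by (auto simp: cinfinite_def)
  obtain b where b: "b \<in> Field r" "a \<noteq> b" "(a, b) \<in> r"
    using infinite_Card_order_limit[OF r assms(2)] by blast
  have "under r a \<subseteq> underS r b"
    using b Card_order_trans[OF r(1)] Card_order_antisym[OF r(1)]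
    unfolding under_def underS_def by blast
  then show ?thesis
    using card_of_underS[OF r(1) b(1)] card_of_mono1 ordLeq_ordLess_trans by blast
qed

section \<open>Cofinality of an infinite cardinal\<close>

lemma finite_not_cofinal:
  assumes "Card_order r" "Field r \<noteq> {}" "finite A" "A \<subseteq> Field r"
  shows "\<not> cofinal A r"
proof
  assume cof: "cofinal A r"
  \<comment> \<open>A finite nonempty set has a maximum, while \<open>cofinal\<close> asks for an
    element of the set strictly above it.\<close>
  have "B = {} \<or> (\<exists>m\<in>B. \<forall>b\<in>B. (b, m) \<in> r)" if "finite B" "B \<subseteq> Field r" for B
    using that
  proof (induction B)
    case (insert x B)
    then consider "B = {}" | m where "m \<in> B" "\<forall>b\<in>B. (b, m) \<in> r"
      by blast
    then show ?case
    proof cases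
      case 1
      then show ?thesis
        using insert.prems Card_order_refl[OF assms(1)] by auto
    next
      case 2
      then show ?thesis
      proof (cases "(x, m) \<in> r")
        case False
        then have "(m, x) \<in> r"
          using Card_order_not_in[OF assms(1), of x m] 2(1) insert.prems by blast
        then have "\<forall>b\<in>insert x B. (b, x) \<in> r"
          using 2 insert.prems Card_order_trans[OF assms(1)] Card_order_refl[OF assms(1)] by blast
        then show ?thesis by blast
      qed (use 2 in blast)
    qed
  qed simp
  from this[OF assms(3,4)] consider "A = {}" | m where "m \<in> A" "\<forall>b\<in>A. (b, m) \<in> r"
    by blast
  then show False
  proof cases
    case 1
    then show ?thesis
      using cof assms(2) by (auto simp: cofinal_def)
  next
    case 2
    then obtain b where "b \<in> A" "m \<noteq> b" "(m, b) \<in> r"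
      using cof assms(4) unfolding cofinal_def by blast
    then show ?thesis
      using 2 Card_order_antisym[OF assms(1)] by blast
  qed
qed

lemma cinfinite_cofinality:
  assumes "Cinfinite r" "is_cofinality \<theta> r"
  shows "Cinfinite \<theta>"
proof -
  obtain A where A: "A \<subseteq> Field r" "cofinal A r" "|A| =o \<theta>" and \<theta>: "Card_order \<theta>"
    using assms(2) unfolding is_cofinality_def by blast
  have "Field r \<noteq> {}"
    using assms(1) by (auto simp: cinfinite_def)
  then have "\<not> finite A"
    using finite_not_cofinal A assms(1) by blast
  then have "cinfinite |A|"
    by (simp add: cinfinite_def Field_card_of)
  then show ?thesis
    using \<theta> A(3) cinfinite_mono ordIso_imp_ordLeq by blast
qed

text \<open>Enumerate a cofinal set of size \<theta> by \<open>e\<close>, in any order. A closed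
  segment of \<theta> has fewer than \<theta> elements, so its image under \<open>e\<close> is
  bounded in \<open>r\<close>; the least bounds increase, not necessarily strictly, and dominate
  \<open>e\<close>.\<close>

lemma cofinality_ladder:
  fixes r :: "'l rel" and \<theta> :: "'t rel"
  assumes "Cinfinite r" "is_cofinality \<theta> r"
  obtains v where "\<And>\<epsilon>. \<epsilon> \<in> Field \<theta> \<Longrightarrow> v \<epsilon> \<in> Field r"
    and "\<And>\<delta> \<epsilon>. (\<delta>, \<epsilon>) \<in> \<theta> \<Longrightarrow> (v \<delta>, v \<epsilon>) \<in> r"
    and "\<And>b. b \<in> Field r \<Longrightarrow> \<exists>\<epsilon>\<in>Field \<theta>. (b, v \<epsilon>) \<in> r"
proof -
  have r: "Card_order r"
    using assms(1) by simp
  have wo: "wo_rel r"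
    using r by (simp add: wo_rel_def card_order_on_well_order_on)
  have \<theta>: "Cinfinite \<theta>"
    using cinfinite_cofinality[OF assms] .
  then have \<theta>': "Card_order \<theta>"
    by simp
  obtain A where A: "A \<subseteq> Field r" "cofinal A r" "|A| =o \<theta>"
    and least: "\<And>B. B \<subseteq> Field r \<Longrightarrow> cofinal B r \<Longrightarrow> \<theta> \<le>o |B|"
    using assms(2) unfolding is_cofinality_def by blast
  have "|Field \<theta>| =o |A|"
    using A(3) \<theta>' card_of_Field_ordIso ordIso_symmetric ordIso_transitive by blast
  then obtain e where e: "bij_betw e (Field \<theta>) A"
    using card_of_ordIso by blast
  define U where "U \<epsilon> = {x \<in> Field r. \<forall>\<delta>\<in>under \<theta> \<epsilon>. (e \<delta>, x) \<in> r}" for \<epsilon>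
  have U: "U \<epsilon> \<noteq> {}" if "\<epsilon> \<in> Field \<theta>" for \<epsilon>
  proof -
    have "|e ` under \<theta> \<epsilon>| <o \<theta>"
      using card_of_under_ordLess[OF \<theta> that] card_of_image ordLeq_ordLess_trans by blast
    moreover have sub: "e ` under \<theta> \<epsilon> \<subseteq> Field r"
      using e A(1) unfolding bij_betw_def under_def Field_def by blast
    ultimately have "\<not> cofinal (e ` under \<theta> \<epsilon>) r"
      using least not_ordLess_ordLeq by blast
    \<comment> \<open>Failure of cofinality only says that no element of the image is strictly above
      \<open>x\<close>; totality of \<open>r\<close> makes \<open>x\<close> an upper bound.\<close>
    then obtain x where "x \<in> Field r" "\<forall>y\<in>e ` under \<theta> \<epsilon>. \<not> (x \<noteq> y \<and> (x, y) \<in> r)"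
      unfolding cofinal_def by blast
    then have "x \<in> U \<epsilon>"
      using sub Card_order_not_in[OF r] Card_order_refl[OF r] unfolding U_def by blast
    then show ?thesis by blast
  qed
  have UF: "U \<epsilon> \<subseteq> Field r" for \<epsilon>
    unfolding U_def by blast
  have v: "wo_rel.minim r (U \<epsilon>) \<in> U \<epsilon>" if "\<epsilon> \<in> Field \<theta>" for \<epsilon>
    using wo_rel.minim_in[OF wo UF U[OF that]] .
  show thesis
  proof (rule that[of "\<lambda>\<epsilon>. wo_rel.minim r (U \<epsilon>)"])
    show "wo_rel.minim r (U \<epsilon>) \<in> Field r" if "\<epsilon> \<in> Field \<theta>" for \<epsilon>
      using v[OF that] UF by blast
    show "(wo_rel.minim r (U \<delta>), wo_rel.minim r (U \<epsilon>)) \<in> r" if "(\<delta>, \<epsilon>) \<in> \<theta>" for \<delta> \<epsilon>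
    proof -
      \<comment> \<open>A longer segment has fewer upper bounds, so the minimum can only move
        up.\<close>
      have "U \<epsilon> \<subseteq> U \<delta>"
        using that Card_order_trans[OF \<theta>'] unfolding U_def under_def by blast
      moreover have "\<epsilon> \<in> Field \<theta>"
        using that by (rule FieldI2)
      ultimately show ?thesis
        using wo_rel.minim_least[OF wo UF] v by blast
    qed
    show "\<exists>\<epsilon>\<in>Field \<theta>. (b, wo_rel.minim r (U \<epsilon>)) \<in> r" if b: "b \<in> Field r" for b
    proof -
      obtain a where a: "a \<in> A" "(b, a) \<in> r"
        using A(2) b unfolding cofinal_def by blast
      then obtain \<epsilon> where \<epsilon>: "\<epsilon> \<in> Field \<theta>" "a = e \<epsilon>"
        using e unfolding bij_betw_def by blast
      \<comment> \<open>The segment is closed, so the bound at \<epsilon> also dominates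
        \<open>e \<epsilon>\<close> itself.\<close>
      then have "(e \<epsilon>, wo_rel.minim r (U \<epsilon>)) \<in> r"
        using v[OF \<epsilon>(1)] Card_order_refl[OF \<theta>' \<epsilon>(1)] unfolding U_def under_def by blast
      then show ?thesis
        using a \<epsilon> Card_order_trans[OF r] by blast
    qed
  qed
qed

text \<open>Koenig's theorem, by diagonalising against the first \<open>c(\<alpha>)\<close> values at coordinate \<open>\<alpha>\<close>.\<close>

lemma ordLess_cexp_cofinal:
  fixes r :: "'l rel" and \<kappa> :: "'k rel"
  assumes "Card_order r" "Field r \<noteq> {}" "cofinal A r" "A \<subseteq> Field r" "|A| \<le>o \<kappa>" "Card_order \<kappa>"
  shows "r <o r ^c \<kappa>"
proof (rule ccontr)
  let ?K = "Field \<kappa>" and ?F = "Func (Field \<kappa>) (Field r)"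
  assume "\<not> r <o r ^c \<kappa>"
  then have "r ^c \<kappa> \<le>o r"
    using not_ordLess_iff_ordLeq[of "r ^c \<kappa>" r] assms(1) Card_order_cexp[of r \<kappa>]
    by (simp add: card_order_on_well_order_on)
  then have "|?F| \<le>o |Field r|"
    unfolding cexp_def using assms(1) card_of_Field_ordIso ordIso_symmetric ordLeq_ordIso_trans by blast
  moreover have F: "?F \<noteq> {}"
    using assms(2) Func_is_emp[of ?K "Field r"] by blast
  ultimately obtain G where G: "G ` Field r = ?F"
    unfolding card_of_ordLeq2[OF F, symmetric] by blast
  have A: "A \<noteq> {}"
    using assms(2,3) unfolding cofinal_def by blast
  have "|A| \<le>o |?K|"
    using assms(5,6) card_of_Field_ordIso ordIso_symmetric ordLeq_ordIso_trans by blast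
  then obtain c where c: "c ` ?K = A"
    unfolding card_of_ordLeq2[OF A, symmetric] by blast
  \<comment> \<open>Fewer than \<open>|Field r|\<close> indices lie strictly below
    \<open>c \<alpha>\<close>, so the corresponding functions cannot take all values at
    \<alpha>.\<close>
  have "\<exists>y\<in>Field r. y \<notin> (\<lambda>\<beta>. G \<beta> \<alpha>) ` underS r (c \<alpha>)" if "\<alpha> \<in> ?K" for \<alpha>
  proof (rule ccontr)
    assume "\<not> ?thesis"
    then have "Field r \<subseteq> (\<lambda>\<beta>. G \<beta> \<alpha>) ` underS r (c \<alpha>)"
      by blast
    then have "|Field r| \<le>o |underS r (c \<alpha>)|"
      using card_of_mono1 card_of_image ordLeq_transitive by blast
    moreover have "|underS r (c \<alpha>)| <o r"
      using card_of_underS[OF assms(1)] c assms(4) that by blast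
    moreover have "r \<le>o |Field r|"
      using card_of_Field_ordIso[OF assms(1)] ordIso_iff_ordLeq by blast
    ultimately show False
      using not_ordLess_ordLeq ordLeq_transitive by blast
  qed
  then obtain s where s: "\<And>\<alpha>. \<alpha> \<in> ?K \<Longrightarrow> s \<alpha> \<in> Field r \<and> s \<alpha> \<notin> (\<lambda>\<beta>. G \<beta> \<alpha>) ` underS r (c \<alpha>)"
    by metis
  have "(\<lambda>\<alpha>. if \<alpha> \<in> ?K then s \<alpha> else undefined) \<in> ?F"
    using s by (auto simp: Func_def)
  then obtain \<beta> where \<beta>: "\<beta> \<in> Field r" "G \<beta> = (\<lambda>\<alpha>. if \<alpha> \<in> ?K then s \<alpha> else undefined)"
    using G by (metis (no_types, lifting) imageE)
  \<comment> \<open>The diagonal function is some \<open>G \<beta>\<close>. Cofinality puts \<beta>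
    strictly below some \<open>c \<alpha>\<close>, where \<open>s\<close> was chosen to avoid
    \<open>G \<beta> \<alpha>\<close>.\<close>
  obtain \<alpha> where \<alpha>: "\<alpha> \<in> ?K" "\<beta> \<noteq> c \<alpha>" "(\<beta>, c \<alpha>) \<in> r"
    using assms(3) \<beta>(1) c unfolding cofinal_def by blast
  then have "G \<beta> \<alpha> \<in> (\<lambda>\<beta>. G \<beta> \<alpha>) ` underS r (c \<alpha>)"
    unfolding underS_def by blast
  then show False
    using s[OF \<alpha>(1)] \<beta>(2) \<alpha>(1) by simp
qed

section \<open>Ultrafilters and embeddings into the ultraproduct\<close>

lemma ultrafilter_on_mono: "ultrafilter_on K D \<Longrightarrow> A \<in> D \<Longrightarrow> A \<subseteq> B \<Longrightarrow> B \<subseteq> K \<Longrightarrow> B \<in> D"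
  unfolding ultrafilter_on_def by blast

lemma ultrafilter_on_Int: "ultrafilter_on K D \<Longrightarrow> A \<in> D \<Longrightarrow> B \<in> D \<Longrightarrow> A \<inter> B \<in> D"
  unfolding ultrafilter_on_def by blast

lemma ultrafilter_on_nonempty: "ultrafilter_on K D \<Longrightarrow> A \<in> D \<Longrightarrow> A \<noteq> {}"
  unfolding ultrafilter_on_def by blast

lemma ultrafilter_on_Diff: "ultrafilter_on K D \<Longrightarrow> A \<subseteq> K \<Longrightarrow> A \<notin> D \<Longrightarrow> K - A \<in> D"
  unfolding ultrafilter_on_def by blast

text \<open>A sequence \<open>s\<close> is cut off at \<open>x i\<close> and the result is coded by
  one element of \<open>X i\<close>. Since \<open>x\<close> exceeds each element of
  \<open>Field r\<close> at \<open>D\<close>-many \<open>i\<close>, every single value of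
  \<open>s\<close> survives the cut at \<open>D\<close>-many \<open>i\<close> and can be recovered
  from the class.\<close>

lemma cexp_ordLeq_ultraproduct:
  fixes r :: "'l rel" and \<kappa> :: "'c rel" and x :: "'k \<Rightarrow> 'l" and X :: "'k \<Rightarrow> 'a set"
  assumes r: "Card_order r" and D: "ultrafilter_on K D"
    and ne: "\<And>i. i \<in> K \<Longrightarrow> X i \<noteq> {}"
    and S: "S \<in> D"
    and x: "\<And>i. i \<in> S \<Longrightarrow> x i \<in> Field r"
    and code: "\<And>i. i \<in> S \<Longrightarrow> |under r (x i)| ^c \<kappa> \<le>o |X i|"
    and lim: "\<And>b. b \<in> Field r \<Longrightarrow> {i \<in> K. (b, x i) \<in> r} \<in> D"
  shows "r ^c \<kappa> \<le>o |ultraproduct K D X|"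
proof -
  let ?C = "Field \<kappa>" and ?P = "\<Pi>\<^sub>E i\<in>K. X i"
  let ?E = "{(f, g). f \<in> ?P \<and> g \<in> ?P \<and> {i \<in> K. f i = g i} \<in> D}"
  have SK: "S \<subseteq> K"
    using S D unfolding ultrafilter_on_def by blast
  have "\<exists>h. h \<in> Func ?C (under r (x i)) \<rightarrow> X i \<and> (i \<in> S \<longrightarrow> inj_on h (Func ?C (under r (x i))))"
    if "i \<in> K" for i
  proof (cases "i \<in> S")
    case True
    then have "|Func ?C (under r (x i))| \<le>o |X i|"
      using code[OF True] by (simp add: cexp_def Field_card_of)
    then obtain h where "inj_on h (Func ?C (under r (x i)))" "h ` Func ?C (under r (x i)) \<subseteq> X i"
      using card_of_ordLeq by metis
    then show ?thesis
      by (intro exI[of _ h]) blast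
  next
    case False
    then show ?thesis
      using ne[OF that] by (intro exI[of _ "\<lambda>_. SOME y. y \<in> X i"]) (simp add: some_in_eq)
  qed
  then have "\<exists>h. \<forall>i\<in>K. h i \<in> Func ?C (under r (x i)) \<rightarrow> X i \<and>
      (i \<in> S \<longrightarrow> inj_on (h i) (Func ?C (under r (x i))))"
    by (intro bchoice ballI)
  then obtain h where h: "\<And>i. i \<in> K \<Longrightarrow> h i \<in> Func ?C (under r (x i)) \<rightarrow> X i"
    and inj: "\<And>i. i \<in> S \<Longrightarrow> inj_on (h i) (Func ?C (under r (x i)))"
    using SK by blast
  \<comment> \<open>The cut replaces values beyond \<open>x i\<close> by \<open>x i\<close>, which
    still lies in the closed segment; \<open>undefined\<close> off \<open>?C\<close> is what
    \<open>Func\<close> demands.\<close>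
  define t where "t s i = (\<lambda>\<alpha>. if \<alpha> \<in> ?C then if (s \<alpha>, x i) \<in> r then s \<alpha> else x i else undefined)"
    for s i
  have t: "t s i \<in> Func ?C (under r (x i))" if "i \<in> S" for s i
    using Card_order_refl[OF r x[OF that]] by (auto simp: t_def Func_def under_def)
  \<comment> \<open>Off \<open>S\<close> no injective coding is at hand, so a fixed element
    independent of \<open>s\<close> fills the coordinate; \<open>undefined\<close> off
    \<open>K\<close> keeps the function extensional.\<close>
  define \<Phi> where "\<Phi> s = (\<lambda>i. if i \<in> S then h i (t s i) else if i \<in> K then SOME y. y \<in> X i else undefined)"
    for s
  have \<Phi>: "\<Phi> s \<in> ?P" for s
  proof (rule PiE_I)
    fix i assume "i \<in> K"
    then show "\<Phi> s i \<in> X i"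
      using h t ne[of i] by (auto simp: \<Phi>_def some_in_eq)
  qed (use SK in \<open>auto simp: \<Phi>_def\<close>)
  have eq: "s = s'" if s: "s \<in> Func ?C (Field r)" "s' \<in> Func ?C (Field r)"
    and agree: "{i \<in> K. \<Phi> s i = \<Phi> s' i} \<in> D" for s s'
  proof (rule ext)
    fix \<alpha>
    show "s \<alpha> = s' \<alpha>"
    proof (cases "\<alpha> \<in> ?C")
      case False
      then show ?thesis
        using s by (simp add: Func_def)
    next
      case True
      then have "s \<alpha> \<in> Field r" "s' \<alpha> \<in> Field r"
        using s by (auto simp: Func_def)
      \<comment> \<open>With \<alpha> fixed first, only four members of \<open>D\<close> are
        intersected: one index \<open>i\<close> in all of them decides
        \<open>s \<alpha> = s' \<alpha>\<close>, and different \<alpha> may use different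
        \<open>i\<close>.\<close>
      then have "{i \<in> K. \<Phi> s i = \<Phi> s' i} \<inter> (S \<inter> ({i \<in> K. (s \<alpha>, x i) \<in> r} \<inter> {i \<in> K. (s' \<alpha>, x i) \<in> r})) \<in> D"
        using agree S lim ultrafilter_on_Int[OF D] by simp
      then obtain i where i: "\<Phi> s i = \<Phi> s' i" "i \<in> S" "(s \<alpha>, x i) \<in> r" "(s' \<alpha>, x i) \<in> r"
        using ultrafilter_on_nonempty[OF D] by blast
      then have "t s i = t s' i"
        using inj[OF i(2)] t[OF i(2)] by (simp add: \<Phi>_def inj_on_eq_iff)
      then have "t s i \<alpha> = t s' i \<alpha>"
        by simp
      then show ?thesis
        using i True by (simp add: t_def)
    qed
  qed
  have "inj_on (\<lambda>s. ?E `` {\<Phi> s}) (Func ?C (Field r))"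
  proof (rule inj_onI)
    fix s s'
    assume s: "s \<in> Func ?C (Field r)" "s' \<in> Func ?C (Field r)" and *: "?E `` {\<Phi> s} = ?E `` {\<Phi> s'}"
    \<comment> \<open>This gives reflexivity: \<open>\<Phi> s'\<close> lies in its own class, hence
      in that of \<open>\<Phi> s\<close>.\<close>
    have "K \<in> D"
      using D by (simp add: ultrafilter_on_def)
    then have "\<Phi> s' \<in> ?E `` {\<Phi> s'}"
      using \<Phi> by simp
    then have "{i \<in> K. \<Phi> s i = \<Phi> s' i} \<in> D"
      unfolding *[symmetric] by simp
    then show "s = s'"
      by (rule eq[OF s])
  qed
  moreover have "?E `` {\<Phi> s} \<in> ultraproduct K D X" for s
    unfolding ultraproduct_def by (intro quotientI \<Phi>)
  ultimately show ?thesis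
    unfolding cexp_def by (rule card_of_ordLeqI)
qed

section \<open>The limit along \<open>D\<close> and the weakly normal function\<close>

lemma is_lim_along_eventually_greater:
  fixes lam :: "'l rel" and p :: "'p rel"
  assumes "ultrafilter_on K D" "is_lim_along K D lams lam" "p <o lam"
  shows "{i \<in> K. p <o lams i} \<in> D"
proof -
  \<comment> \<open>The limit is tested only against well-orders on the type of \<open>lam\<close>,
    so \<open>p\<close> is first copied into that type.\<close>
  obtain \<beta> :: "'l rel" where \<beta>: "p =o \<beta>" "\<beta> <o lam"
    using assms(3) unfolding internalize_ordLess[of p lam] by blast
  have "{i \<in> K. \<beta> <o lams i \<and> lams i \<le>o lam} \<in> D"
    using is_lim_alongD[OF assms(2) \<beta>(2)] .
  then show ?thesis
    by (rule ultrafilter_on_mono[OF assms(1)]) (use \<beta>(1) ordIso_ordLess_trans in blast)+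
qed

theorem theorem2p2:
  fixes \<kappa> :: "'k rel" and lam :: "'l rel" and \<theta> :: "'t rel"
    and lams :: "'k \<Rightarrow> 'a rel" and D :: "'k set set"
  assumes "Cinfinite \<kappa>" and "Card_order lam"
    and "is_cofinality \<theta> lam" and "\<theta> \<le>o \<kappa>" and "\<kappa> <o lam"
    and "\<And>i. i \<in> Field \<kappa> \<Longrightarrow> Cinfinite (lams i)"
    and "is_lim_along (Field \<kappa>) D lams lam"
    and "\<And>i. i \<in> Field \<kappa> \<Longrightarrow> lams i ^c \<kappa> <o lam"
    and "ultrafilter_on (Field \<kappa>) D"
    and "\<not> closed_under_descending D \<theta>"
    and "|ultraproduct (Field \<kappa>) D (\<lambda>i. Field (lams i))| =o lam"
  shows "weakly_normal (Field \<kappa>) D \<theta>"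
proof -
  let ?K = "Field \<kappa>"
  note D = assms(9) and lim = assms(7)
  have \<kappa>: "Card_order \<kappa>" and lam: "Cinfinite lam" and lam': "Card_order lam"
    using assms(1,2,5) cinfinite_mono ordLess_imp_ordLeq by blast+
  have \<theta>: "Cinfinite \<theta>"
    using cinfinite_cofinality[OF lam assms(3)] .
  then have \<theta>': "Card_order \<theta>"
    by simp
  obtain v where v: "\<And>\<epsilon>. \<epsilon> \<in> Field \<theta> \<Longrightarrow> v \<epsilon> \<in> Field lam"
    and mono: "\<And>\<delta> \<epsilon>. (\<delta>, \<epsilon>) \<in> \<theta> \<Longrightarrow> (v \<delta>, v \<epsilon>) \<in> lam"
    and cof: "\<And>b. b \<in> Field lam \<Longrightarrow> \<exists>\<epsilon>\<in>Field \<theta>. (b, v \<epsilon>) \<in> lam"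
    using cofinality_ladder[OF lam assms(3)] by blast
  define small where "small i \<epsilon> \<longleftrightarrow> |under lam (v \<epsilon>)| ^c \<kappa> <o lams i" for i \<epsilon>
  have small_D: "{i \<in> ?K. small i \<epsilon>} \<in> D" if "\<epsilon> \<in> Field \<theta>" for \<epsilon>
  proof -
    have "|under lam (v \<epsilon>)| <o lam"
      using card_of_under_ordLess[OF lam v[OF that]] .
    \<comment> \<open>One index \<open>j\<close> suffices: with it the bound on
      \<open>lams j ^c \<kappa>\<close> keeps the power of the segment below \<open>lam\<close>, and
      then the limit can be applied to that power.\<close>
    then obtain j where j: "j \<in> ?K" "|under lam (v \<epsilon>)| <o lams j"
      using ultrafilter_on_nonempty[OF D is_lim_along_eventually_greater[OF D lim]] by blast
    then have "|under lam (v \<epsilon>)| ^c \<kappa> \<le>o lams j ^c \<kappa>"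
      using cexp_mono1 \<kappa> ordLess_imp_ordLeq by blast
    then have "|under lam (v \<epsilon>)| ^c \<kappa> <o lam"
      using assms(8)[OF j(1)] ordLeq_ordLess_trans by blast
    then show ?thesis
      unfolding small_def by (rule is_lim_along_eventually_greater[OF D lim])
  qed
  have small_down: "small i \<delta>" if "(\<delta>, \<epsilon>) \<in> \<theta>" "small i \<epsilon>" for i \<delta> \<epsilon>
  proof -
    have "under lam (v \<delta>) \<subseteq> under lam (v \<epsilon>)"
      using mono[OF that(1)] Card_order_trans[OF lam'] unfolding under_def by blast
    then have "|under lam (v \<delta>)| ^c \<kappa> \<le>o |under lam (v \<epsilon>)| ^c \<kappa>"
      using cexp_mono1[OF card_of_mono1 \<kappa>] by blast
    then show ?thesis
      using that(2) ordLeq_ordLess_trans unfolding small_def by blast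
  qed
  have not_small: "\<exists>\<epsilon>\<in>Field \<theta>. \<not> small i \<epsilon>" if i: "i \<in> ?K" for i
  proof -
    have lami: "Card_order (lams i)" "Cnotzero \<kappa>"
      using assms(1) assms(6)[OF i] Cinfinite_Cnotzero by blast+
    have "lams i \<le>o lams i ^c \<kappa>"
      using ordLeq_cexp1[OF lami(2,1)] .
    then have "lams i <o lam"
      using assms(8)[OF i] ordLeq_ordLess_trans by blast
    \<comment> \<open>As \<open>lams i\<close> is below \<open>lam\<close>, it is a copy of the
      segment below some \<open>b\<close>. Once \<open>v \<epsilon>\<close> reaches
      \<open>b\<close>, the segment under \<open>v \<epsilon>\<close> has at least
      \<open>lams i\<close> elements, and so does its power.\<close>
    then obtain b where b: "b \<in> Field lam" "lams i =o Restr lam (underS lam b)"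
      using lami(1) lam' ordLess_iff_ordIso_Restr card_order_on_well_order_on by metis
    obtain \<epsilon> where \<epsilon>: "\<epsilon> \<in> Field \<theta>" "(b, v \<epsilon>) \<in> lam"
      using cof[OF b(1)] by blast
    have "Field (Restr lam (underS lam b)) \<subseteq> under lam (v \<epsilon>)"
      using \<epsilon>(2) Card_order_trans[OF lam'] unfolding Field_def under_def underS_def by blast
    moreover have "lams i \<le>o |Field (Restr lam (underS lam b))|"
      using b(2) lami(1) card_of_Field_ordIso card_of_cong ordIso_iff_ordLeq ordIso_symmetric
        ordIso_transitive by metis
    ultimately have "lams i \<le>o |under lam (v \<epsilon>)|"
      using card_of_mono1 ordLeq_transitive by blast
    moreover have "|under lam (v \<epsilon>)| \<le>o |under lam (v \<epsilon>)| ^c \<kappa>"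
      using ordLeq_cexp1[OF lami(2) card_of_Card_order] .
    ultimately have "\<not> small i \<epsilon>"
      using not_ordLess_ordLeq ordLeq_transitive unfolding small_def by blast
    then show ?thesis
      using \<epsilon>(1) by blast
  qed
  have "\<exists>\<gamma>\<in>Field \<theta>. \<not> small i \<gamma> \<and> (\<forall>\<delta>. olt \<theta> \<delta> \<gamma> \<longrightarrow> small i \<delta>)" if i: "i \<in> ?K" for i
  proof -
    let ?B = "{\<epsilon> \<in> Field \<theta>. \<not> small i \<epsilon>}"
    have wo: "wo_rel \<theta>"
      using \<theta>' by (simp add: wo_rel_def card_order_on_well_order_on)
    have sub: "?B \<subseteq> Field \<theta>" and B: "?B \<noteq> {}"
      using not_small[OF i] by blast+
    have "small i \<delta>" if "olt \<theta> \<delta> (wo_rel.minim \<theta> ?B)" for \<delta>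
      using that wo_rel.minim_least[OF wo sub, of \<delta>] Card_order_antisym[OF \<theta>']
      by (auto simp: olt_def intro: FieldI1)
    then show ?thesis
      using wo_rel.minim_in[OF wo sub B] by blast
  qed
  then obtain g where g: "\<And>i. i \<in> ?K \<Longrightarrow> g i \<in> Field \<theta>"
    and g_not: "\<And>i. i \<in> ?K \<Longrightarrow> \<not> small i (g i)"
    and g_less: "\<And>i \<delta>. i \<in> ?K \<Longrightarrow> olt \<theta> \<delta> (g i) \<Longrightarrow> small i \<delta>"
    by metis
  have g_D: "{i \<in> ?K. (\<epsilon>, g i) \<in> \<theta>} \<in> D" if "\<epsilon> \<in> Field \<theta>" for \<epsilon>
  proof (rule ultrafilter_on_mono[OF D small_D[OF that]])
    show "{i \<in> ?K. small i \<epsilon>} \<subseteq> {i \<in> ?K. (\<epsilon>, g i) \<in> \<theta>}"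
      \<comment> \<open>If \<open>g i\<close> were strictly below \<epsilon>, smallness would pass
        down from \<epsilon> to \<open>g i\<close>, where it fails.\<close>
      using small_down g_not Card_order_not_in[OF \<theta>' that g] by blast
  qed blast
  have "\<exists>j\<in>Field \<theta>. {i \<in> ?K. olt \<theta> (f i) j} \<in> D" if f: "regressive ?K \<theta> g f" for f
  proof (rule ccontr)
    assume unbdd: "\<not> ?thesis"
    have fF: "f i \<in> Field \<theta>" if "i \<in> ?K" for i
      using f that unfolding regressive_def by blast
    \<comment> \<open>An ultrafilter that omits the set where \<open>f\<close> is below
      \<open>j\<close> contains its complement.\<close>
    have f_D: "{i \<in> ?K. (j, f i) \<in> \<theta>} \<in> D" if j: "j \<in> Field \<theta>" for j
    proof (rule ultrafilter_on_mono[OF D ultrafilter_on_Diff[OF D]])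
      show "{i \<in> ?K. olt \<theta> (f i) j} \<notin> D"
        using unbdd j by blast
      show "?K - {i \<in> ?K. olt \<theta> (f i) j} \<subseteq> {i \<in> ?K. (j, f i) \<in> \<theta>}"
        using Card_order_not_in[OF \<theta>' j fF] unfolding olt_def by blast
    qed blast+
    define S where "S = {i \<in> ?K. olt \<theta> (f i) (g i)}"
    have "infinite (Field \<theta>)"
      using \<theta> by (simp add: cinfinite_def)
    \<comment> \<open>Regressiveness says nothing where \<open>g i\<close> is zero. An \<epsilon>
      with a predecessor exists, and \<open>g i\<close> is at least \<epsilon>, hence nonzero, for
      \<open>D\<close>-many \<open>i\<close>.\<close>
    then obtain \<epsilon>0 \<epsilon> where \<epsilon>: "\<epsilon> \<in> Field \<theta>" "(\<epsilon>0, \<epsilon>) \<in> \<theta>" "\<epsilon>0 \<noteq> \<epsilon>"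
      using infinite_Card_order_limit[OF \<theta>'] by (metis finite.emptyI ex_in_conv)
    have "underS \<theta> (g i) \<noteq> {}" if "(\<epsilon>, g i) \<in> \<theta>" for i
      using \<epsilon> that Card_order_trans[OF \<theta>'] Card_order_antisym[OF \<theta>'] unfolding underS_def by blast
    then have "{i \<in> ?K. (\<epsilon>, g i) \<in> \<theta>} \<subseteq> S"
      using f unfolding S_def regressive_def by blast
    then have S: "S \<in> D"
      using ultrafilter_on_mono[OF D g_D[OF \<epsilon>(1)]] unfolding S_def by blast
    have "lam ^c \<kappa> \<le>o |ultraproduct ?K D (\<lambda>i. Field (lams i))|"
    proof (rule cexp_ordLeq_ultraproduct[OF lam' D _ S, where x = "\<lambda>i. v (f i)"])
      show "Field (lams i) \<noteq> {}" if "i \<in> ?K" for i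
        using assms(6)[OF that] by (auto simp: cinfinite_def)
      show "v (f i) \<in> Field lam" if "i \<in> S" for i
        using that fF v unfolding S_def by blast
      show "|under lam (v (f i))| ^c \<kappa> \<le>o |Field (lams i)|" if "i \<in> S" for i
      proof -
        \<comment> \<open>On \<open>S\<close> the value \<open>f i\<close> lies below the first
          failure \<open>g i\<close>, so smallness holds at \<open>f i\<close> and supplies the
          coding.\<close>
        have "i \<in> ?K" "small i (f i)"
          using that g_less unfolding S_def by blast+
        then show ?thesis
          using assms(6) card_of_Field_ordIso ordIso_symmetric ordLess_imp_ordLeq ordLeq_ordIso_trans
          unfolding small_def by blast
      qed
      show "{i \<in> ?K. (b, v (f i)) \<in> lam} \<in> D" if b: "b \<in> Field lam" for b
      proof -
        obtain j where j: "j \<in> Field \<theta>" "(b, v j) \<in> lam"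
          using cof[OF b] by blast
        have "{i \<in> ?K. (j, f i) \<in> \<theta>} \<subseteq> {i \<in> ?K. (b, v (f i)) \<in> lam}"
          using mono j(2) Card_order_trans[OF lam'] by blast
        then show ?thesis
          using ultrafilter_on_mono[OF D f_D[OF j(1)]] by blast
      qed
    qed
    then have "lam ^c \<kappa> \<le>o lam"
      using assms(11) ordLeq_ordIso_trans by blast
    moreover obtain A where A: "A \<subseteq> Field lam" "cofinal A lam" "|A| =o \<theta>"
      using assms(3) unfolding is_cofinality_def by blast
    \<comment> \<open>The cofinality \<theta> of \<open>lam\<close> is at most \<kappa>, so a
      cofinal set of size \<theta> is short enough for the diagonal argument.\<close>
    have "lam <o lam ^c \<kappa>"
    proof (rule ordLess_cexp_cofinal[OF lam' _ A(2,1) _ \<kappa>])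
      show "Field lam \<noteq> {}"
        using lam by (auto simp: cinfinite_def)
      show "|A| \<le>o \<kappa>"
        using A(3) assms(4) ordIso_ordLeq_trans by blast
    qed
    ultimately show False
      using not_ordLess_ordLeq by blast
  qed
  then have "weakly_normal_wrt ?K D \<theta> g"
    using g g_D unfolding weakly_normal_wrt_def by blast
  then show ?thesis
    unfolding weakly_normal_def by blast
qed

end
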